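(* Let $G$ be a finite abstract simplicial complex and let $m\ge1$ and $k\ge1$ be integers. For $X=(x_1,\dots,x_k)\in G^k$ let $w(X)=\prod_{j=1}^kw(x_j)$, $U(X)=\bigcap_{j=1}^kU(x_j)$, $B(X)=\overline{U(X)}$ and $S(X)=B(X)\setminus U(X)$. Then $$ \sum_{X\in G^k} w(X)\,w_m(S(X))=0. $$
   Context: A finite abstract simplicial complex $G$ is a finite set of non-empty finite sets, closed under taking non-empty subsets. For $x\in G$, $\dim(x)=|x|-1$ and $w(x)=(-1)^{\dim(x)}$. The star of $x\in G$ is $U(x)=\{y\in G : x\subseteq y\}$. The closure of $A\subseteq G$ is $\overline{A}=\{z\in G : z\subseteq y\text{ for some }y\in A\}$, the smallest subcomplex of $G$ containing $A$. For any subset $A\subseteq G$, the $m$-th characteristic of $A$ is $$ w_m(A)=\sum_{(x_1,\dots,x_m)\in A^m,\ x_1\cap\cdots\cap x_m\in A}\ \prod_{j=1}^m w(x_j), $$ with $w_m(\emptyset)=0$. *)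

theory Defs
  imports "HOL-Library.FuncSet"
begin

definition finite_simplicial_complex :: "'a set set \<Rightarrow> bool" where
  "finite_simplicial_complex G \<longleftrightarrow>
     finite G \<and> (\<forall>x\<in>G. finite x \<and> x \<noteq> {}) \<and>
     (\<forall>x\<in>G. \<forall>y. y \<subseteq> x \<and> y \<noteq> {} \<longrightarrow> y \<in> G)"

text \<open>Only meant for non-empty finite sets: the natural-number subtraction truncates
  at the empty set, which never belongs to a complex.\<close>

definition simplex_dim :: "'a set \<Rightarrow> nat" where
  "simplex_dim x = card x - 1"

definition simplex_sign :: "'a set \<Rightarrow> int" where
  "simplex_sign x = (- 1) ^ simplex_dim x"

definition star :: "'a set set \<Rightarrow> 'a set \<Rightarrow> 'a set set" where
  "star G x = {y \<in> G. x \<subseteq> y}"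

definition complex_closure :: "'a set set \<Rightarrow> 'a set set \<Rightarrow> 'a set set" where
  "complex_closure G A = {z \<in> G. \<exists>y\<in>A. z \<subseteq> y}"

text \<open>An $m$-tuple over $A$ is an element of the extensional function space from
  \<open>{..<m}\<close> to $A$.\<close>

abbreviation tuples :: "nat \<Rightarrow> 'b set \<Rightarrow> (nat \<Rightarrow> 'b) set" where
  "tuples m A \<equiv> PiE {..<m} (\<lambda>_. A)"

text \<open>The $m$-th characteristic, for $m \ge 1$ (for $m = 0$ the intersection below
  would be \<open>UNIV\<close>).\<close>

definition characteristic :: "nat \<Rightarrow> 'a set set \<Rightarrow> int" where
  "characteristic m A =
     (\<Sum>x \<in> {x \<in> tuples m A. (\<Inter>j<m. x j) \<in> A}. \<Prod>j<m. simplex_sign (x j))"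

definition tuple_sign :: "nat \<Rightarrow> (nat \<Rightarrow> 'a set) \<Rightarrow> int" where
  "tuple_sign k X = (\<Prod>j<k. simplex_sign (X j))"

definition tuple_star :: "'a set set \<Rightarrow> nat \<Rightarrow> (nat \<Rightarrow> 'a set) \<Rightarrow> 'a set set" where
  "tuple_star G k X = (\<Inter>j<k. star G (X j))"

definition tuple_ball :: "'a set set \<Rightarrow> nat \<Rightarrow> (nat \<Rightarrow> 'a set) \<Rightarrow> 'a set set" where
  "tuple_ball G k X = complex_closure G (tuple_star G k X)"

definition tuple_sphere :: "'a set set \<Rightarrow> nat \<Rightarrow> (nat \<Rightarrow> 'a set) \<Rightarrow> 'a set set" where
  "tuple_sphere G k X = tuple_ball G k X - tuple_star G k X"

end

theory Submission
  imports Defs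
begin

text \<open>Expand \<open>w_m(S(X))\<close> and exchange the two sums: for a fixed tuple \<open>(x_1, \<dots>, x_m)\<close> it
  suffices that the signs \<open>w(X)\<close> cancel over all \<open>X\<close> whose sphere contains every \<open>x_j\<close> and
  \<open>z = x_1 \<inter> \<dots> \<inter> x_m\<close>. Fix a vertex \<open>v \<in> z\<close>. A set containing \<open>v\<close> lies in \<open>S(X)\<close> or not
  regardless of which entries of \<open>X\<close> contain \<open>v\<close>. Since \<open>z \<in> S(X)\<close>, not all entries of \<open>X\<close>
  equal \<open>{v}\<close>, and toggling \<open>v\<close> in the first entry different from \<open>{v}\<close> is a sign-reversing
  involution.\<close>

definition toggle :: "'a \<Rightarrow> 'a set \<Rightarrow> 'a set" where
  "toggle v s = (if v \<in> s then s - {v} else insert v s)"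

lemma toggle_toggle [simp]: "toggle v (toggle v s) = s"
  by (auto simp: toggle_def)

lemma toggle_diff_singleton [simp]: "toggle v s - {v} = s - {v}"
  by (auto simp: toggle_def)

lemma toggle_neq_singleton: "s \<noteq> {} \<Longrightarrow> toggle v s \<noteq> {v}"
  by (auto simp: toggle_def)

lemma toggle_nonempty: "s \<noteq> {v} \<Longrightarrow> toggle v s \<noteq> {}"
  by (auto simp: toggle_def)

text \<open>Adding or removing \<open>v\<close> changes the cardinality by one. Both
  \<open>{}\<close> and \<open>{v}\<close> must be excluded: they are swapped by
  \<open>toggle v\<close>, but the truncated dimension gives both the sign 1.\<close>

lemma simplex_sign_toggle:
  assumes "finite s" "s \<noteq> {}" "s \<noteq> {v}"
  shows "simplex_sign (toggle v s) = - simplex_sign s"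
proof (cases "v \<in> s")
  case True
  then obtain t where t: "s = insert v t" "v \<notin> t"
    by (meson Set.set_insert)
  then have "card t > 0" using assms by (auto simp: card_gt_0_iff)
  then obtain n where "card t = Suc n"
    using gr0_implies_Suc by blast
  then show ?thesis using t assms(1)
    by (simp add: toggle_def simplex_sign_def simplex_dim_def)
next
  case False
  have "card s > 0" using assms by (auto simp: card_gt_0_iff)
  then obtain n where "card s = Suc n"
    using gr0_implies_Suc by blast
  then show ?thesis using False assms(1)
    by (simp add: toggle_def simplex_sign_def simplex_dim_def)
qed

text \<open>The search for \<open>i\<close> is not bounded by the tuple length: any entry below
  \<open>k\<close> other than \<open>{v}\<close> already forces the least index below
  \<open>k\<close>.\<close>

definition flip :: "'a \<Rightarrow> (nat \<Rightarrow> 'a set) \<Rightarrow> nat \<Rightarrow> 'a set" where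
  "flip v X = (let i = LEAST i. X i \<noteq> {v} in X(i := toggle v (X i)))"

lemma flip_diff_singleton: "flip v X j - {v} = X j - {v}"
  by (simp add: flip_def Let_def)

text \<open>The second flip selects the same index: earlier entries are still \<open>{v}\<close>,
  and toggling a non-empty set never yields \<open>{v}\<close>.\<close>

lemma flip_flip:
  assumes "X i \<noteq> {v}" "\<And>j. j \<le> i \<Longrightarrow> X j \<noteq> {}"
  shows "flip v (flip v X) = X"
proof -
  define l where "l = (LEAST i. X i \<noteq> {v})"
  have "l \<le> i"
    unfolding l_def using assms(1) by (rule Least_le)
  have flip: "flip v X = X(l := toggle v (X l))"
    by (simp add: flip_def l_def Let_def)
  have "(LEAST j. flip v X j \<noteq> {v}) = l"
  proof (rule Least_equality)
    show "flip v X l \<noteq> {v}"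
      using assms(2)[OF \<open>l \<le> i\<close>] by (simp add: flip toggle_neq_singleton)
    show "l \<le> j" if "flip v X j \<noteq> {v}" for j
      using that not_less_Least[of j "\<lambda>i. X i \<noteq> {v}"]
      by (cases "j = l") (auto simp: flip l_def[symmetric] not_less[symmetric])
  qed
  then show ?thesis
    by (subst flip_def) (simp add: flip)
qed

lemma mem_tuple_sphere_iff:
  assumes "k \<ge> 1"
  shows "z \<in> tuple_sphere G k X \<longleftrightarrow>
    z \<in> G \<and> (\<exists>y\<in>G. z \<subseteq> y \<and> (\<forall>j<k. X j \<subseteq> y)) \<and> (\<exists>j<k. \<not> X j \<subseteq> z)"
proof -
  have star: "y \<in> tuple_star G k X \<longleftrightarrow> y \<in> G \<and> (\<forall>j<k. X j \<subseteq> y)" for y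
    \<comment> \<open>An index below \<open>k\<close> is needed to get \<open>y \<in> G\<close>,
      since an empty intersection of stars would be \<open>UNIV\<close>.\<close>
    using less_le_trans[OF zero_less_one assms]
    unfolding tuple_star_def star_def INT_iff mem_Collect_eq lessThan_iff by blast
  show ?thesis
    unfolding tuple_sphere_def tuple_ball_def complex_closure_def Diff_iff mem_Collect_eq Bex_def star
    by blast
qed

text \<open>Membership of \<open>z\<close> only tests inclusions of entries in \<open>z\<close> or
  in supersets of \<open>z\<close>. All of these contain \<open>v\<close>, so \<open>v\<close> is
  irrelevant to the inclusions.\<close>

lemma mem_tuple_sphere_cong:
  assumes "k \<ge> 1" "v \<in> z" "\<And>j. X j - {v} = Y j - {v}"
  shows "z \<in> tuple_sphere G k X \<longleftrightarrow> z \<in> tuple_sphere G k Y"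
proof -
  have "X j \<subseteq> y \<longleftrightarrow> Y j \<subseteq> y" if "v \<in> y" for j y
    using assms(3)[of j] that by blast
  then have "(z \<subseteq> y \<and> (\<forall>j<k. X j \<subseteq> y)) \<longleftrightarrow> (z \<subseteq> y \<and> (\<forall>j<k. Y j \<subseteq> y))"
      "X j \<subseteq> z \<longleftrightarrow> Y j \<subseteq> z" for y j
    using assms(2) by blast+
  then show ?thesis
    by (simp only: mem_tuple_sphere_iff[OF assms(1)])
qed

text \<open>\<open>Z\<close> will consist of the entries of an \<open>m\<close>-tuple and their
  intersection \<open>z\<close>. As \<open>z\<close> is the least member, a vertex of
  \<open>z\<close> lies in every member, so one flip respects all membership conditions at
  once.\<close>

lemma sum_tuple_sign_spheres_containing:
  assumes G: "finite_simplicial_complex G" and k: "k \<ge> 1"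
    and z: "z \<in> Z" "\<And>y. y \<in> Z \<Longrightarrow> z \<subseteq> y"
  shows "(\<Sum>X | X \<in> tuples k G \<and> Z \<subseteq> tuple_sphere G k X. tuple_sign k X) = 0"
    (is "sum _ ?T = 0")
proof (cases "z = {}")
  case True
  have "{} \<notin> tuple_sphere G k X" for X
    using G unfolding mem_tuple_sphere_iff[OF k] finite_simplicial_complex_def by blast
  then have "?T = {}" using True z(1) by blast
  then show ?thesis by (simp only: sum.empty)
next
  case False
  then obtain v where v: "v \<in> z" by blast
  have flip: "flip v X \<in> ?T \<and> flip v (flip v X) = X \<and> tuple_sign k (flip v X) = - tuple_sign k X"
    if X: "X \<in> ?T" for X
  proof -
    define l where "l = (LEAST i. X i \<noteq> {v})"
    have flip: "flip v X = X(l := toggle v (X l))"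
      by (simp add: flip_def l_def Let_def)
    have XG: "X \<in> tuples k G" and Z: "Z \<subseteq> tuple_sphere G k X" using X by auto
    have simplex: "finite (X j)" "X j \<noteq> {}" if "j < k" for j
      using XG that G by (auto simp: finite_simplicial_complex_def PiE_def Pi_def)
    have "z \<in> tuple_sphere G k X" using Z z(1) by blast
    then obtain y i where y: "y \<in> G" "z \<subseteq> y" "\<And>j. j < k \<Longrightarrow> X j \<subseteq> y"
      and i: "i < k" "\<not> X i \<subseteq> z"
      unfolding mem_tuple_sphere_iff[OF k] by blast
    have Xi: "X i \<noteq> {v}" using i(2) v by auto
    have "l \<le> i" unfolding l_def using Xi by (rule Least_le)
    then have l: "l < k" using i(1) by simp
    have Xl: "X l \<noteq> {v}" unfolding l_def using Xi by (rule LeastI)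
    \<comment> \<open>The flipped entry stays in the complex because the simplex \<open>y\<close>,
      which witnesses that \<open>z\<close> is in the ball, contains both \<open>v\<close> and
      \<open>X l\<close>.\<close>
    have "toggle v (X l) \<subseteq> y"
      using y(2) y(3)[OF l] v by (auto simp: toggle_def)
    then have "toggle v (X l) \<in> G"
      using G y(1) toggle_nonempty[OF Xl] unfolding finite_simplicial_complex_def by blast
    then have "flip v X \<in> tuples k G"
      using XG l by (auto simp: flip PiE_def extensional_def)
    moreover have "Z \<subseteq> tuple_sphere G k (flip v X)"
    proof
      fix y assume "y \<in> Z"
      then have "v \<in> y" "y \<in> tuple_sphere G k X" using z(2) v Z by auto
      then show "y \<in> tuple_sphere G k (flip v X)"
        using mem_tuple_sphere_cong[OF k, of v y "flip v X" X] flip_diff_singleton by metis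
    qed
    moreover have "flip v (flip v X) = X"
      using flip_flip[of X i v] Xi simplex(2) i(1) by simp
    moreover have "tuple_sign k (flip v X) = - tuple_sign k X"
    proof -
      have split: "tuple_sign k Y = simplex_sign (Y l) * (\<Prod>j\<in>{..<k}-{l}. simplex_sign (Y j))" for Y
        unfolding tuple_sign_def using l by (intro prod.remove) auto
      have "(\<Prod>j\<in>{..<k}-{l}. simplex_sign (flip v X j))
          = (\<Prod>j\<in>{..<k}-{l}. simplex_sign (X j))"
        by (rule prod.cong) (auto simp: flip)
      moreover have "simplex_sign (flip v X l) = - simplex_sign (X l)"
        using simplex_sign_toggle[OF simplex[OF l] Xl] by (simp add: flip)
      ultimately show ?thesis by (simp only: split mult_minus_left)
    qed
    ultimately show ?thesis by simp
  qed
  have "sum (tuple_sign k) ?T = (\<Sum>X\<in>?T. - tuple_sign k X)"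
    by (rule sum.reindex_bij_witness[where i = "flip v" and j = "flip v"])
      (use flip in auto)
  then show ?thesis by (simp add: sum_negf)
qed

theorem theorem2:
  fixes G :: "'a set set" and m k :: nat
  assumes "finite_simplicial_complex G"
    and "m \<ge> 1" and "k \<ge> 1"
  shows "(\<Sum>X \<in> tuples k G. tuple_sign k X * characteristic m (tuple_sphere G k X)) = 0"
proof -
  \<comment> \<open>\<open>Z x\<close> merges the two conditions on a tuple in
    \<open>characteristic\<close> into one inclusion. Tuples then range over \<open>G\<close>,
    independently of \<open>X\<close>, and the sums can be swapped.\<close>
  define Z where "Z x = insert (\<Inter>j<m. x j) (x ` {..<m})" for x :: "nat \<Rightarrow> 'a set"
  have "finite G" using assms(1) by (simp add: finite_simplicial_complex_def)
  then have fin: "finite (tuples n G)" for n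
    by (intro finite_PiE) auto
  have "tuple_sphere G k X \<subseteq> G" for X
    unfolding mem_tuple_sphere_iff[OF assms(3)] subset_iff by blast
  then have tuples: "{x \<in> tuples m (tuple_sphere G k X). (\<Inter>j<m. x j) \<in> tuple_sphere G k X}
      = {x \<in> tuples m G. Z x \<subseteq> tuple_sphere G k X}" for X
    unfolding Z_def PiE_iff insert_subset image_subset_iff by (intro Collect_cong) blast
  have "(\<Sum>X \<in> tuples k G. tuple_sign k X * characteristic m (tuple_sphere G k X))
      = (\<Sum>X \<in> tuples k G. \<Sum>x \<in> tuples m G.
          if Z x \<subseteq> tuple_sphere G k X then tuple_sign k X * tuple_sign m x else 0)"
    unfolding characteristic_def tuples tuple_sign_def[of m, symmetric]
    by (auto simp: sum_distrib_left sum.inter_filter[OF fin] intro!: sum.cong)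
  also have "\<dots> = (\<Sum>x \<in> tuples m G. \<Sum>X \<in> tuples k G.
          if Z x \<subseteq> tuple_sphere G k X then tuple_sign k X * tuple_sign m x else 0)"
    by (rule sum.swap)
  also have "\<dots> = (\<Sum>x \<in> tuples m G.
      (\<Sum>X | X \<in> tuples k G \<and> Z x \<subseteq> tuple_sphere G k X. tuple_sign k X) * tuple_sign m x)"
    by (auto simp: sum_distrib_right sum.inter_filter[OF fin] intro!: sum.cong)
  also have "\<dots> = 0"
  proof (rule sum.neutral, rule ballI)
    fix x :: "nat \<Rightarrow> 'a set"
    have "(\<Sum>X | X \<in> tuples k G \<and> Z x \<subseteq> tuple_sphere G k X. tuple_sign k X) = 0"
      by (rule sum_tuple_sign_spheres_containing[OF assms(1,3), where z = "\<Inter>j<m. x j"])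
        (auto simp: Z_def)
    then show "(\<Sum>X | X \<in> tuples k G \<and> Z x \<subseteq> tuple_sphere G k X. tuple_sign k X)
        * tuple_sign m x = 0"
      by simp
  qed
  finally show ?thesis .
qed

end
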